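(* Let $G_1$ and $G_2$ be directed graphs without self-loops on the common vertex set $[n]=\{1,\dots,n\}$. If $G_1$ and $G_2$ are distribution equivalent, i.e. $\mathcal{P}(G_1)=\mathcal{P}(G_2)$, then $G_1$ and $G_2$ have the same strongly connected components (the partitions of $[n]$ into strongly connected components of $G_1$ and of $G_2$ coincide).
   Context: For a directed graph $G$ on $[n]$ without self-loops, let $B_G\in\{0,1\}^{n\times n}$ be its adjacency matrix with $[B_G]_{ij}=1$ iff there is an edge $j\to i$. A linear structural causal model consistent with $G$ is $\mathbf{x}=W\mathbf{x}+\mathbf{e}$ where $W\in\mathbb{R}^{n\times n}$ has $\{(i,j):W_{ij}\neq 0\}=\{(i,j):[B_G]_{ij}=1\}$, $I-W$ is invertible, and the noise vector $\mathbf{e}$ has jointly independent components of which at most one is Gaussian. The distribution set $\mathcal{P}(G)$ is the set of all distributions of $\mathbf{x}=(I-W)^{-1}\mathbf{e}$ arising from all such $W$ and all such noise distributions. $G_1,G_2$ are distribution equivalent if $\mathcal{P}(G_1)=\mathcal{P}(G_2)$. Two vertices $u,v$ are strongly connected if there are directed paths from $u$ to $v$ and from $v$ to $u$; the equivalence classes of this relation are the strongly connected components. *)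

theory Defs
  imports "HOL-Probability.Probability"
begin

text \<open>Vertices are the elements of a finite type 'n (playing the role of [n]).
  A directed graph is an edge set G; (j,i) \<in> G means an edge j \<rightarrow> i.
  Matrices are real^'n^'n, with W $ i $ j the (i,j) entry.\<close>

definition no_self_loops :: "('n \<times> 'n) set \<Rightarrow> bool" where
  "no_self_loops G \<longleftrightarrow> (\<forall>i. (i, i) \<notin> G)"

text \<open>W is consistent with G: its support is exactly the adjacency pattern B_G.\<close>
definition consistent_weights :: "('n \<times> 'n) set \<Rightarrow> real^'n^'n \<Rightarrow> bool" where
  "consistent_weights G W \<longleftrightarrow> (\<forall>i j. W $ i $ j \<noteq> 0 \<longleftrightarrow> (j, i) \<in> G)"

text \<open>A (non-degenerate) Gaussian distribution on the reals.\<close>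
definition gaussian_measure :: "real measure \<Rightarrow> bool" where
  "gaussian_measure \<mu> \<longleftrightarrow> (\<exists>m \<sigma>. \<sigma> > 0 \<and> \<mu> = density lborel (normal_density m \<sigma>))"

text \<open>Admissible noise: a family of Borel probability distributions for the
  components; jointly independent, so the noise vector has the product distribution;
  at most one component is Gaussian.\<close>
definition admissible_noise :: "('n \<Rightarrow> real measure) \<Rightarrow> bool" where
  "admissible_noise \<mu> \<longleftrightarrow>
     (\<forall>i. prob_space (\<mu> i) \<and> sets (\<mu> i) = sets borel) \<and>
     card {i. gaussian_measure (\<mu> i)} \<le> 1"

text \<open>Distribution of x = (I - W)^{-1} e where e has independent components with laws \<mu> i.\<close>
definition sem_distribution :: "real^'n^'n \<Rightarrow> ('n::finite \<Rightarrow> real measure) \<Rightarrow> (real^'n) measure" where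
  "sem_distribution W \<mu> =
     distr (PiM UNIV \<mu>) borel (\<lambda>e. matrix_inv (mat 1 - W) *v (\<chi> i. e i))"

definition distribution_set :: "('n::finite \<times> 'n) set \<Rightarrow> (real^'n) measure set" where
  "distribution_set G =
     {sem_distribution W \<mu> | W \<mu>. consistent_weights G W \<and> invertible (mat 1 - W)
                                  \<and> admissible_noise \<mu>}"

definition distribution_equivalent :: "('n::finite \<times> 'n) set \<Rightarrow> ('n \<times> 'n) set \<Rightarrow> bool" where
  "distribution_equivalent G1 G2 \<longleftrightarrow> distribution_set G1 = distribution_set G2"

definition strongly_connected :: "('n \<times> 'n) set \<Rightarrow> 'n \<Rightarrow> 'n \<Rightarrow> bool" where
  "strongly_connected G u v \<longleftrightarrow> (u, v) \<in> G\<^sup>* \<and> (v, u) \<in> G\<^sup>*"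

definition sc_rel :: "('n \<times> 'n) set \<Rightarrow> ('n \<times> 'n) set" where
  "sc_rel G = {(u, v). strongly_connected G u v}"

definition scc_partition :: "('n \<times> 'n) set \<Rightarrow> 'n set set" where
  "scc_partition G = UNIV // sc_rel G"

end

theory Submission
  imports Defs
begin

text \<open>Give G1 independent fair coins on {0, 1} as noise. The atoms of the resulting law are the
  points x with (I - W1) x in the cube {0, 1}^n. If the same law arises from G2 with weights W2
  and noise \<mu>, its atoms are also the points x with (I - W2) x in the box A1 \<times> ... \<times> An of
  atoms of the \<mu> i. So B = (I - W2)(I - W1)^-1 maps the cube onto a box, which forces every row
  of B to have a single nonzero entry: B is a permutation \<sigma> times a diagonal matrix. Row i of
  I - W2 is then a multiple of row \<sigma> i of I - W1, so every edge k \<rightarrow> i of G2 yields a path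
  k \<rightarrow>* \<sigma> i in G1, and the unit diagonal of I - W2 yields paths i \<rightarrow>* \<sigma> i; following the cycles
  of \<sigma> leads from \<sigma> i back to i. Hence G2 \<subseteq> G1*, and by symmetry both graphs have the same
  reachability relation.\<close>

lemma matrix_inv_right:
  fixes A :: "'a::field^'n^'n"
  assumes "invertible A"
  shows "A ** matrix_inv A = mat 1"
  using someI_ex[OF assms[unfolded invertible_def]] unfolding matrix_inv_def by auto

lemma matrix_inv_left:
  fixes A :: "'a::field^'n^'n"
  assumes "invertible A"
  shows "matrix_inv A ** A = mat 1"
  using someI_ex[OF assms[unfolded invertible_def]] unfolding matrix_inv_def by auto

lemma invertible_matrix_inv:
  fixes A :: "'a::field^'n^'n"
  assumes "invertible A"
  shows "invertible (matrix_inv A)"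
  using matrix_inv_left[OF assms] matrix_inv_right[OF assms] unfolding invertible_def by blast

lemma matrix_inv_mult_eq_iff:
  fixes A :: "'a::field^'n^'n"
  assumes "invertible A"
  shows "matrix_inv A *v y = x \<longleftrightarrow> y = A *v x"
proof
  assume "matrix_inv A *v y = x"
  then show "y = A *v x"
    by (auto simp: matrix_vector_mul_assoc matrix_inv_right[OF assms])
next
  assume "y = A *v x"
  then show "matrix_inv A *v y = x"
    by (simp add: matrix_vector_mul_assoc matrix_inv_left[OF assms])
qed

lemma image_matrix_inv_mult:
  fixes A :: "'a::field^'n^'n"
  assumes "invertible A"
  shows "(*v) (matrix_inv A) ` S = {x. A *v x \<in> S}"
proof -
  have "x \<in> (*v) (matrix_inv A) ` S \<longleftrightarrow> (\<exists>y\<in>S. matrix_inv A *v y = x)" for x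
    by blast
  then show ?thesis
    by (auto simp: matrix_inv_mult_eq_iff[OF assms])
qed

lemma matrix_vector_mult_axis_component:
  "((M::'a::semiring_1^'n::finite^'m) *v axis j a) $ i = M $ i $ j * a"
  by (simp add: matrix_vector_mult_def axis_def if_distrib cong: if_cong)

lemma invertible_row_nonzero:
  fixes M :: "'a::field^'n::finite^'n"
  assumes "invertible M"
  obtains j where "M $ i $ j \<noteq> 0"
proof -
  have "row i M \<noteq> 0"
    using assms det_zero_row(2)[of i M] by (auto simp: invertible_det_nz)
  then show ?thesis
    using that by (auto simp: row_def vec_eq_iff)
qed

lemma invertible_column_nonzero:
  fixes M :: "'a::field^'n::finite^'n"
  assumes "invertible M"
  obtains i where "M $ i $ j \<noteq> 0"
proof -
  have "column j M \<noteq> 0"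
    using assms det_zero_column(2)[of j M] by (auto simp: invertible_det_nz)
  then show ?thesis
    using that by (auto simp: column_def vec_eq_iff)
qed

lemma invertible_mat_1_minus:
  fixes W :: "real^'n::finite^'n"
  assumes small: "\<And>i. (\<Sum>j\<in>UNIV. \<bar>W $ i $ j\<bar>) < 1"
  shows "invertible (mat 1 - W)"
proof -
  have "x = 0" if "(mat 1 - W) *v x = 0" for x :: "real^'n"
  proof -
    have fixed: "W *v x = x"
      using that by (simp add: matrix_vector_mult_diff_rdistrib)
    define m where "m = Max (range (\<lambda>j. \<bar>x $ j\<bar>))"
    have le_m: "\<bar>x $ j\<bar> \<le> m" for j
      unfolding m_def by (rule Max_ge) auto
    have "m \<in> range (\<lambda>j. \<bar>x $ j\<bar>)"
      unfolding m_def by (rule Max_in) auto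
    then obtain i where i: "m = \<bar>x $ i\<bar>"
      by blast
    have "m = \<bar>(W *v x) $ i\<bar>"
      using i fixed by simp
    also have "\<dots> = \<bar>\<Sum>j\<in>UNIV. W $ i $ j * x $ j\<bar>"
      by (simp add: matrix_vector_mult_def)
    also have "\<dots> \<le> (\<Sum>j\<in>UNIV. \<bar>W $ i $ j\<bar> * m)"
      by (rule order.trans[OF sum_abs sum_mono]) (simp add: abs_mult mult_left_mono le_m)
    also have "\<dots> = (\<Sum>j\<in>UNIV. \<bar>W $ i $ j\<bar>) * m"
      by (simp add: sum_distrib_right)
    finally have "m \<le> (\<Sum>j\<in>UNIV. \<bar>W $ i $ j\<bar>) * m" .
    then have "m \<le> 0"
      using small[of i] by (simp add: mult_le_cancel_right1)
    then have "\<bar>x $ j\<bar> \<le> 0" for j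
      using le_m[of j] by linarith
    then show "x = 0"
      by (simp add: vec_eq_iff)
  qed
  then show ?thesis
    by (simp add: invertible_left_inverse matrix_left_invertible_ker)
qed

lemma ex_consistent_weights_invertible:
  fixes G :: "('n::finite \<times> 'n) set"
  obtains W where "consistent_weights G W" and "invertible (mat 1 - W)"
proof -
  define \<epsilon> :: real where "\<epsilon> = 1 / (2 * real CARD('n))"
  have \<epsilon>: "\<epsilon> > 0" "real CARD('n) * \<epsilon> < 1"
    unfolding \<epsilon>_def by simp_all
  define W :: "real^'n^'n" where "W = (\<chi> i j. if (j, i) \<in> G then \<epsilon> else 0)"
  have "consistent_weights G W"
    using \<epsilon>(1) by (simp add: consistent_weights_def W_def)
  moreover have "invertible (mat 1 - W)"
  proof (rule invertible_mat_1_minus)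
    fix i
    have "(\<Sum>j\<in>UNIV. \<bar>W $ i $ j\<bar>) \<le> (\<Sum>j\<in>(UNIV::'n set). \<epsilon>)"
      using \<epsilon>(1) by (intro sum_mono) (simp add: W_def)
    also have "\<dots> = real CARD('n) * \<epsilon>"
      by simp
    finally show "(\<Sum>j\<in>UNIV. \<bar>W $ i $ j\<bar>) < 1"
      using \<epsilon>(2) by linarith
  qed
  ultimately show ?thesis
    by (rule that)
qed

lemma matrix_mult_component_single_support:
  fixes B M :: "'a::semiring_1^'n::finite^'n"
  assumes "\<And>j. B $ i $ j \<noteq> 0 \<Longrightarrow> j = s"
  shows "(B ** M) $ i $ k = B $ i $ s * M $ s $ k"
proof -
  have zero: "B $ i $ j = 0" if "j \<noteq> s" for j
    using assms that by blast
  have "(B ** M) $ i $ k = (\<Sum>j\<in>UNIV. B $ i $ j * M $ j $ k)"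
    by (simp add: matrix_matrix_mult_def)
  also have "\<dots> = (\<Sum>j\<in>UNIV. if j = s then B $ i $ j * M $ j $ k else 0)"
    using zero by (intro sum.cong) auto
  finally show ?thesis
    by simp
qed

definition row_monomial :: "'a::zero^'n^'m \<Rightarrow> bool" where
  "row_monomial B \<longleftrightarrow> (\<forall>i j k. B $ i $ j \<noteq> 0 \<longrightarrow> B $ i $ k \<noteq> 0 \<longrightarrow> j = k)"

lemma invertible_row_monomial_support_bij:
  fixes B :: "'a::field^'n::finite^'n"
  assumes "invertible B" and "row_monomial B"
  obtains \<sigma> where "bij \<sigma>" and "\<And>i j. B $ i $ j \<noteq> 0 \<longleftrightarrow> j = \<sigma> i"
proof -
  define \<sigma> where "\<sigma> i = (SOME j. B $ i $ j \<noteq> 0)" for i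
  have "B $ i $ \<sigma> i \<noteq> 0" for i
    unfolding \<sigma>_def by (rule invertible_row_nonzero[OF assms(1), of i]) (rule someI)
  then have supp: "B $ i $ j \<noteq> 0 \<longleftrightarrow> j = \<sigma> i" for i j
    using assms(2) unfolding row_monomial_def by blast
  have "j \<in> range \<sigma>" for j
  proof -
    obtain i where "B $ i $ j \<noteq> 0"
      using invertible_column_nonzero[OF assms(1)] .
    then show ?thesis
      using supp by auto
  qed
  then have "surj \<sigma>"
    by blast
  then have "bij \<sigma>"
    by (simp add: bij_def finite_UNIV_surj_inj)
  then show ?thesis
    using supp by (rule that)
qed

lemma permutation_rtrancl_reverse_step:
  assumes "permutation \<sigma>" and step: "\<And>a. (a, \<sigma> a) \<in> R\<^sup>*"
  shows "(\<sigma> a, a) \<in> R\<^sup>*"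
proof -
  obtain n where n: "n > 0" "(\<sigma> ^^ n) a = a"
    using permutation_self[OF assms(1)] by blast
  have iterate: "(b, (\<sigma> ^^ m) b) \<in> R\<^sup>*" for b m
    by (induction m) (auto intro: rtrancl_trans step)
  obtain k where "n = Suc k"
    using n(1) gr0_implies_Suc by blast
  then have "(\<sigma> ^^ k) (\<sigma> a) = a"
    using n(2) by (simp only: funpow_Suc_right comp_apply)
  then show ?thesis
    using iterate[of "\<sigma> a" k] by simp
qed

lemma mat_1_minus_component:
  "(mat 1 - W) $ i $ k = (if i = k then 1 else 0) - (W :: 'a::ring_1^'n^'n) $ i $ k"
  by (simp add: mat_def)

lemma edges_subset_rtrancl_if_row_monomial_factor:
  fixes W1 W2 B :: "real^'n::finite^'n"
  assumes cons1: "consistent_weights G1 W1" and cons2: "consistent_weights G2 W2"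
    and loops: "no_self_loops G2"
    and B: "invertible B" "row_monomial B" and factor: "mat 1 - W2 = B ** (mat 1 - W1)"
  shows "G2 \<subseteq> G1\<^sup>*"
proof -
  obtain \<sigma> where bij: "bij \<sigma>" and supp: "\<And>i j. B $ i $ j \<noteq> 0 \<longleftrightarrow> j = \<sigma> i"
    using invertible_row_monomial_support_bij[OF B] by blast
  have row: "(mat 1 - W2) $ i $ k = B $ i $ \<sigma> i * (mat 1 - W1) $ \<sigma> i $ k" for i k
    unfolding factor by (rule matrix_mult_component_single_support) (simp add: supp)
  have path: "(k, \<sigma> i) \<in> G1\<^sup>*" if "(mat 1 - W2) $ i $ k \<noteq> 0" for i k
  proof -
    have "(mat 1 - W1) $ \<sigma> i $ k \<noteq> 0"
      using that row by (metis mult_zero_right)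
    then have "k = \<sigma> i \<or> W1 $ \<sigma> i $ k \<noteq> 0"
      unfolding mat_1_minus_component by (auto split: if_splits)
    then show ?thesis
      using cons1 by (auto simp: consistent_weights_def)
  qed
  have diag: "(mat 1 - W2) $ i $ i \<noteq> 0" for i
  proof -
    have "W2 $ i $ i = 0"
      using cons2 loops unfolding consistent_weights_def no_self_loops_def by blast
    then show ?thesis
      unfolding mat_1_minus_component by simp
  qed
  have "permutation \<sigma>"
    using bij by (simp add: permutation)
  then have return: "(\<sigma> i, i) \<in> G1\<^sup>*" for i
    by (rule permutation_rtrancl_reverse_step) (rule path[OF diag])
  show ?thesis
  proof
    fix e assume "e \<in> G2"
    then obtain k i where e: "e = (k, i)" "(k, i) \<in> G2"
      by (cases e) auto
    then have "k \<noteq> i" and "W2 $ i $ k \<noteq> 0"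
      using cons2 loops unfolding consistent_weights_def no_self_loops_def by auto
    then have "(mat 1 - W2) $ i $ k \<noteq> 0"
      unfolding mat_1_minus_component by simp
    then have "(k, \<sigma> i) \<in> G1\<^sup>*"
      by (rule path)
    then show "e \<in> G1\<^sup>*"
      unfolding e(1) using return by (rule rtrancl_trans)
  qed
qed

definition binary_vectors :: "(real^'n) set" where
  "binary_vectors = {s. \<forall>i. s $ i \<in> {0, 1}}"

text \<open>Since the box contains B 0 = 0, it contains the projection of B s to the i-th axis, whose
  preimage under B is (B s) i times the i-th column of B^-1.\<close>

lemma binary_image_box_axis_pullback:
  fixes B :: "real^'n::finite^'n"
  assumes B: "invertible B" and box: "(*v) B ` binary_vectors = {y. \<forall>i. y $ i \<in> A i}"
    and s: "s \<in> binary_vectors"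
  shows "(B *v s) $ i * matrix_inv B $ l $ i \<in> {0, 1}"
proof -
  let ?a = "(B *v s) $ i"
  have "B *v s \<in> (*v) B ` binary_vectors" and "0 \<in> (*v) B ` binary_vectors"
    using s by (auto intro!: image_eqI[of 0 _ 0] simp: binary_vectors_def)
  then have "?a \<in> A i" and "0 \<in> A m" for m
    unfolding box by auto
  then have "axis i ?a \<in> (*v) B ` binary_vectors"
    unfolding box by (auto simp: axis_def)
  then obtain t where t: "t \<in> binary_vectors" "axis i ?a = B *v t"
    by blast
  then have "matrix_inv B *v axis i ?a = t"
    unfolding matrix_inv_mult_eq_iff[OF B] by simp
  then have "t $ l = matrix_inv B $ l $ i * ?a"
    by (auto simp: matrix_vector_mult_axis_component)
  moreover have "t $ l \<in> {0, 1}"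
    using t(1) by (simp add: binary_vectors_def)
  ultimately show ?thesis
    by (metis mult.commute)
qed

lemma row_monomial_if_binary_image_box:
  fixes B :: "real^'n::finite^'n"
  assumes B: "invertible B" and box: "(*v) B ` binary_vectors = {y. \<forall>i. y $ i \<in> A i}"
  shows "row_monomial B"
  unfolding row_monomial_def
proof (intro allI impI)
  fix i j k
  assume bj: "B $ i $ j \<noteq> 0" and bk: "B $ i $ k \<noteq> 0"
  obtain l where l: "matrix_inv B $ l $ i \<noteq> 0"
    using invertible_column_nonzero[OF invertible_matrix_inv[OF B]] by blast
  let ?c = "matrix_inv B $ l $ i"
  have column: "(B *v axis m 1) $ i = B $ i $ m" for m
    by (simp add: matrix_vector_mult_axis_component)
  have unit: "B $ i $ m * ?c \<in> {0, 1}" for m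
  proof -
    have "axis m 1 \<in> binary_vectors"
      by (simp add: binary_vectors_def axis_def)
    from binary_image_box_axis_pullback[OF B box this, where i = i and l = l] show ?thesis
      unfolding column .
  qed
  show "j = k"
  proof (rule ccontr)
    assume "j \<noteq> k"
    then have "axis j 1 + axis k 1 \<in> binary_vectors"
      by (simp add: binary_vectors_def axis_def)
    from binary_image_box_axis_pullback[OF B box this, where i = i and l = l]
    have "(B $ i $ j + B $ i $ k) * ?c \<in> {0, 1}"
      by (simp add: matrix_vector_right_distrib column)
    moreover have "B $ i $ j * ?c = 1" and "B $ i $ k * ?c = 1"
      using unit[of j] unit[of k] bj bk l by auto
    ultimately show False
      by (simp add: distrib_right)
  qed
qed

lemma measurable_matrix_vector_mult_PiM:
  fixes A :: "real^'n::finite^'m::finite"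
  assumes "\<And>i. sets (\<mu> i) = sets borel"
  shows "(\<lambda>e. A *v (\<chi> i. e i)) \<in> borel_measurable (PiM UNIV \<mu>)"
proof -
  have "sets (PiM UNIV \<mu>) = sets (PiM UNIV (\<lambda>_. borel))"
    by (rule sets_PiM_cong) (auto simp: assms)
  then have eq: "borel_measurable (PiM UNIV \<mu>) = (borel_measurable (PiM UNIV (\<lambda>_. borel)) :: (('n \<Rightarrow> real) \<Rightarrow> real^'m) set)"
    by (rule measurable_cong_sets) simp
  have "(\<lambda>e. (A *v (\<chi> i. e i)) $ k) \<in> borel_measurable (PiM UNIV (\<lambda>_. borel))" for k
    unfolding matrix_vector_mult_def by simp
  then show ?thesis
    unfolding eq by (subst borel_measurable_euclidean_space) (auto simp: Basis_vec_def cart_eq_inner_axis[symmetric])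
qed

lemma emeasure_sem_distribution_singleton:
  fixes W :: "real^'n::finite^'n"
  assumes sets: "\<And>i. sets (\<mu> i) = sets borel" and prob: "\<And>i. prob_space (\<mu> i)"
    and inv: "invertible (mat 1 - W)"
  shows "emeasure (sem_distribution W \<mu>) {x} = (\<Prod>i\<in>UNIV. emeasure (\<mu> i) {((mat 1 - W) *v x) $ i})"
proof -
  interpret product_sigma_finite \<mu>
    unfolding product_sigma_finite_def using prob by (simp add: prob_space_imp_sigma_finite)
  have space: "space (\<mu> i) = UNIV" for i
    using sets_eq_imp_space_eq[OF sets[of i]] by simp
  have "(\<lambda>e. matrix_inv (mat 1 - W) *v (\<chi> i. e i)) -` {x} \<inter> space (PiM UNIV \<mu>)
      = PiE UNIV (\<lambda>i. {((mat 1 - W) *v x) $ i})"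
  proof -
    have "matrix_inv (mat 1 - W) *v (\<chi> i. e i) = x \<longleftrightarrow> (\<forall>i. e i = ((mat 1 - W) *v x) $ i)" for e
      unfolding matrix_inv_mult_eq_iff[OF inv] by (simp add: vec_eq_iff)
    then show ?thesis
      by (auto simp: space_PiM space PiE_def extensional_def Pi_iff)
  qed
  then show ?thesis
    unfolding sem_distribution_def
    by (subst emeasure_distr) (auto simp: measurable_matrix_vector_mult_PiM sets emeasure_PiM)
qed

lemma atoms_sem_distribution:
  fixes W :: "real^'n::finite^'n"
  assumes "\<And>i. sets (\<mu> i) = sets borel" and "\<And>i. prob_space (\<mu> i)"
    and inv: "invertible (mat 1 - W)"
  shows "{x. emeasure (sem_distribution W \<mu>) {x} \<noteq> 0}
    = (*v) (matrix_inv (mat 1 - W)) ` {y. \<forall>i. emeasure (\<mu> i) {y $ i} \<noteq> 0}"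
  by (simp add: image_matrix_inv_mult[OF inv] emeasure_sem_distribution_singleton[OF assms]
      ennreal_prod_eq_0)

definition fair_coin :: "real measure" where
  "fair_coin = distr (measure_pmf (bernoulli_pmf (1/2))) borel of_bool"

lemma sets_fair_coin [simp]: "sets fair_coin = sets borel"
  by (simp add: fair_coin_def)

lemma prob_space_fair_coin: "prob_space fair_coin"
  unfolding fair_coin_def by (rule prob_space.prob_space_distr) (auto simp: measure_pmf.prob_space_axioms)

lemma atoms_fair_coin: "emeasure fair_coin {c} \<noteq> 0 \<longleftrightarrow> c \<in> {0, 1}"
proof -
  have "of_bool -` {c} = (if c = 0 then {False} else if c = 1 then {True} else {})"
    by auto
  then show ?thesis
    unfolding fair_coin_def by (subst emeasure_distr) (auto simp: emeasure_pmf_single)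
qed

lemma gaussian_measure_singleton:
  assumes "gaussian_measure \<mu>"
  shows "emeasure \<mu> {c} = 0"
proof -
  obtain m \<sigma> where \<mu>: "\<mu> = density lborel (normal_density m \<sigma>)"
    using assms unfolding gaussian_measure_def by auto
  have "AE x in lborel. x \<in> {c} \<longrightarrow> ennreal (normal_density m \<sigma> x) = 0"
    by (rule AE_I'[OF finite_imp_null_set_lborel[of "{c}"]]) auto
  then have "{c} \<in> null_sets \<mu>"
    unfolding \<mu> by (subst null_sets_density_iff) auto
  then show ?thesis
    by auto
qed

lemma admissible_noise_fair_coin: "admissible_noise (\<lambda>_. fair_coin)"
proof -
  have "\<not> gaussian_measure fair_coin"
    using gaussian_measure_singleton[of fair_coin 0] atoms_fair_coin[of 0] by auto
  then show ?thesis
    using prob_space_fair_coin by (simp add: admissible_noise_def)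
qed

lemma binary_image_box_if_sem_distribution_fair_coin:
  fixes W1 W2 :: "real^'n::finite^'n"
  assumes inv1: "invertible (mat 1 - W1)" and inv2: "invertible (mat 1 - W2)"
    and sets: "\<And>i. sets (\<mu> i) = sets borel" and prob: "\<And>i. prob_space (\<mu> i)"
    and eq: "sem_distribution W1 (\<lambda>_. fair_coin) = sem_distribution W2 \<mu>"
  shows "(*v) ((mat 1 - W2) ** matrix_inv (mat 1 - W1)) ` binary_vectors
    = {y. \<forall>i. y $ i \<in> {c. emeasure (\<mu> i) {c} \<noteq> 0}}"
proof -
  let ?box = "{y. \<forall>i. emeasure (\<mu> i) {y $ i} \<noteq> 0}"
  have "(*v) (matrix_inv (mat 1 - W1)) ` binary_vectors
      = {x. emeasure (sem_distribution W1 (\<lambda>_. fair_coin)) {x} \<noteq> 0}"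
    unfolding binary_vectors_def
    by (simp add: atoms_sem_distribution[OF _ prob_space_fair_coin inv1] atoms_fair_coin)
  also have "\<dots> = (*v) (matrix_inv (mat 1 - W2)) ` ?box"
    unfolding eq by (rule atoms_sem_distribution[OF sets prob inv2])
  finally have atoms: "(*v) (matrix_inv (mat 1 - W1)) ` binary_vectors
      = (*v) (matrix_inv (mat 1 - W2)) ` ?box" .
  have "(*v) ((mat 1 - W2) ** matrix_inv (mat 1 - W1)) ` binary_vectors
      = (*v) (mat 1 - W2) ` (*v) (matrix_inv (mat 1 - W1)) ` binary_vectors"
    by (simp add: image_image matrix_vector_mul_assoc)
  also have "\<dots> = ?box"
    unfolding atoms by (simp add: image_image matrix_vector_mul_assoc matrix_inv_right[OF inv2])
  finally show ?thesis
    by simp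
qed

lemma distribution_set_subset_imp_subset_rtrancl:
  fixes G1 G2 :: "('n::finite \<times> 'n) set"
  assumes loops: "no_self_loops G2" and sub: "distribution_set G1 \<subseteq> distribution_set G2"
  shows "G2 \<subseteq> G1\<^sup>*"
proof -
  obtain W1 where W1: "consistent_weights G1 W1" "invertible (mat 1 - W1)"
    using ex_consistent_weights_invertible by blast
  have "sem_distribution W1 (\<lambda>_. fair_coin) \<in> distribution_set G2"
    using sub W1 admissible_noise_fair_coin unfolding distribution_set_def by blast
  then obtain W2 \<mu> where W2: "consistent_weights G2 W2" "invertible (mat 1 - W2)"
    and \<mu>: "admissible_noise \<mu>" and eq: "sem_distribution W1 (\<lambda>_. fair_coin) = sem_distribution W2 \<mu>"
    unfolding distribution_set_def by auto
  define B where "B = (mat 1 - W2) ** matrix_inv (mat 1 - W1)"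
  have B: "invertible B"
    unfolding B_def using W1(2) W2(2) by (simp add: invertible_mult invertible_matrix_inv)
  moreover have "(*v) B ` binary_vectors = {y. \<forall>i. y $ i \<in> {c. emeasure (\<mu> i) {c} \<noteq> 0}}"
    unfolding B_def using W1(2) W2(2) \<mu> eq
    by (intro binary_image_box_if_sem_distribution_fair_coin) (auto simp: admissible_noise_def)
  ultimately have "row_monomial B"
    by (rule row_monomial_if_binary_image_box)
  moreover have "mat 1 - W2 = B ** (mat 1 - W1)"
    unfolding B_def by (simp add: matrix_mul_assoc[symmetric] matrix_inv_left[OF W1(2)])
  ultimately show ?thesis
    by (rule edges_subset_rtrancl_if_row_monomial_factor[OF W1(1) W2(1) loops B])
qed

theorem theorem1:
  fixes G1 G2 :: "('n::finite \<times> 'n) set"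
  assumes "no_self_loops G1" and "no_self_loops G2"
    and "distribution_equivalent G1 G2"
  shows "scc_partition G1 = scc_partition G2"
proof -
  have eq: "distribution_set G1 = distribution_set G2"
    using assms(3) unfolding distribution_equivalent_def .
  have "G2 \<subseteq> G1\<^sup>*"
    by (rule distribution_set_subset_imp_subset_rtrancl[OF assms(2)]) (simp add: eq)
  moreover have "G1 \<subseteq> G2\<^sup>*"
    by (rule distribution_set_subset_imp_subset_rtrancl[OF assms(1)]) (simp add: eq)
  ultimately have "G1\<^sup>* = G2\<^sup>*"
    by (metis rtrancl_subset_rtrancl subset_antisym)
  then show ?thesis
    unfolding scc_partition_def sc_rel_def strongly_connected_def by simp
qed

end
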